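(* For any cardinal $\kappa\ge\omega$ and natural number $m$, $w\chi_{\rm CF}(\beth_m(\kappa),\kappa,2)\ge\left\lfloor m/2\right\rfloor+2$.
   Context: $\beth_0(\kappa)=\kappa$, $\beth_{r+1}(\kappa)=2^{\beth_r(\kappa)}$. A weak conflict free coloring of a family $\mathcal A$ with $\rho$ colors is a function $f$ with $\operatorname{dom}(f)\subseteq\bigcup\mathcal A$, values in $\rho$, such that every $A\in\mathcal A$ has some $\zeta$ with $|A\cap f^{-1}\{\zeta\}|=1$; $w\chi_{\rm CF}(\mathcal A)$ is the least such $\rho$. A $(\lambda,\kappa,\mu)$-system is a family of $\lambda$ sets each of size $\kappa$, distinct members meeting in fewer than $\mu$ points; $w\chi_{\rm CF}(\lambda,\kappa,\mu)$ is the supremum of $w\chi_{\rm CF}(\mathcal A)$ over all $(\lambda,\kappa,\mu)$-systems. *)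

theory Defs
  imports Main "HOL-Library.Equipollence"
begin

text \<open>A beth chain of length m starting at the infinite set B 0, realised inside one ground type:
  |B 0| = kappa and |B (i+1)| = 2^|B i|, hence |B r| = beth_r(kappa) for r \<le> m.\<close>
definition beth_chain :: "nat \<Rightarrow> (nat \<Rightarrow> 'b set) \<Rightarrow> bool" where
  "beth_chain m B \<longleftrightarrow> (\<forall>i<m. B (Suc i) \<approx> Pow (B i))"

text \<open>A (lambda,kappa,mu)-system, with the cardinals lambda, kappa, mu given by representing sets.\<close>
definition is_system :: "'b set set \<Rightarrow> 'l set \<Rightarrow> 'k set \<Rightarrow> 'm set \<Rightarrow> bool" where
  "is_system \<A> L K M \<longleftrightarrow> \<A> \<approx> L \<and> (\<forall>A\<in>\<A>. A \<approx> K) \<and>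
     (\<forall>A\<in>\<A>. \<forall>A'\<in>\<A>. A \<noteq> A' \<longrightarrow> A \<inter> A' \<prec> M)"

text \<open>Weak conflict free colouring of a family with colour set C: a partial function
  (None = uncoloured) with domain inside the union of the family and values in C.\<close>
definition weak_cf_colouring :: "'b set set \<Rightarrow> 'c set \<Rightarrow> ('b \<Rightarrow> 'c option) \<Rightarrow> bool" where
  "weak_cf_colouring \<A> C f \<longleftrightarrow> dom f \<subseteq> \<Union>\<A> \<and> ran f \<subseteq> C \<and>
     (\<forall>A\<in>\<A>. \<exists>\<zeta>. card {x\<in>A. f x = Some \<zeta>} = 1)"

end

theory Submission
  imports Defs
begin

text \<open>Suppose a family \<open>\<A>\<close> of size \<open>\<lambda>\<close> on \<open>V\<close> has no weak conflict free colouring with \<open>n\<close> colours,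
  and let \<open>f\<close> use \<open>n + 1\<close> colours. In every copy of \<open>\<A>\<close>, forgetting the last colour leaves some
  \<open>A\<close> without a unique colour below \<open>n\<close>, and some point of the copy must have the last colour,
  or else \<open>A\<close> is already bad for \<open>f\<close>. So it suffices to extend, in some copy, this \<open>A\<close> by two points
  of the last colour lying outside the copy. The main copies are indexed by pairs \<open>(t, u)\<close>, where
  \<open>t\<close> codes a function \<open>\<A> \<Rightarrow> V\<close> and \<open>u\<close> codes a function \<open>\<A> \<times> {t} \<Rightarrow> V\<close>; the two extra points are \<open>t A\<close>
  in an auxiliary copy indexed by \<open>(A, u)\<close>, and \<open>u (A, t)\<close> in one indexed by \<open>(A, t)\<close>. Any two points
  of the extended set then determine \<open>A\<close>, \<open>t\<close> and \<open>u\<close>, so the new family stays linear. Taking for \<open>u\<close>,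
  and then for \<open>t\<close>, the selection of points of the last colour in the auxiliary copies makes both
  extra points have that colour. One additional colour thus costs two exponentials.\<close>

section \<open>Cardinal arithmetic\<close>

lemma lepoll_iff_card_of_ordLeq: "A \<lesssim> B \<longleftrightarrow> (card_of A, card_of B) \<in> ordLeq"
  by (simp add: card_of_ordLeq[symmetric] lepoll_def)

lemma lepoll_infinite: "A \<lesssim> B \<Longrightarrow> infinite A \<Longrightarrow> infinite B"
  by (meson infinite_le_lepoll lepoll_trans)

lemma lepoll_Times_infinite:
  assumes "infinite L" "A \<lesssim> L" "B \<lesssim> L"
  shows "A \<times> B \<lesssim> L"
proof -
  have "L \<times> L \<approx> L"
    using card_of_Times_same_infinite[OF assms(1)] by (simp add: eqpoll_iff_card_of_ordIso)
  with times_lepoll_mono[OF assms(2,3)] show ?thesis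
    by (rule lepoll_trans2)
qed

lemma lepoll_Plus_infinite:
  assumes "infinite L" "A \<lesssim> L" "B \<lesssim> L"
  shows "A <+> B \<lesssim> L"
proof -
  have "L <+> L \<approx> L"
    using card_of_Plus_infinite1[OF assms(1) card_of_mono1[OF subset_refl]] by (simp add: eqpoll_iff_card_of_ordIso)
  with sum_lepoll_mono[OF assms(2,3)] show ?thesis
    by (rule lepoll_trans2)
qed

lemma lepoll_Un_infinite:
  assumes "infinite L" "A \<lesssim> L" "B \<lesssim> L"
  shows "A \<union> B \<lesssim> L"
proof -
  have "A \<union> B = (\<lambda>z. case z of Inl a \<Rightarrow> a | Inr b \<Rightarrow> b) ` (A <+> B)"
    by (force simp: image_iff Plus_def)
  then show ?thesis
    by (metis lepoll_Plus_infinite[OF assms] image_lepoll lepoll_trans)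
qed

lemma lepoll_Union_infinite:
  assumes "infinite L" "\<A> \<lesssim> L" "\<And>A. A \<in> \<A> \<Longrightarrow> A \<lesssim> L"
  shows "\<Union>\<A> \<lesssim> L"
  using card_of_UNION_ordLeq_infinite[OF assms(1), of \<A> "\<lambda>A. A"] assms(2,3)
  by (simp add: lepoll_iff_card_of_ordLeq)

text \<open>A function \<open>p\<close> from \<open>X\<close> to \<open>V\<close> is coded by its
  graph, carried into \<open>L\<close> and read as an element of \<open>Pow L\<close>. For a
  \<open>t\<close> that codes no graph, \<open>ev t x\<close> is an arbitrary value, possibly
  outside \<open>V\<close>; only the fact that every \<open>p\<close> has a code is claimed.\<close>

lemma power_set_codes_functions:
  assumes "X \<times> V \<lesssim> L" "M \<approx> Pow L"
  obtains ev :: "'m \<Rightarrow> 'x \<Rightarrow> 'v"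
  where "\<And>p. (\<And>x. x \<in> X \<Longrightarrow> p x \<in> V) \<Longrightarrow> \<exists>t\<in>M. \<forall>x\<in>X. ev t x = p x"
proof -
  obtain g where g: "inj_on g (X \<times> V)" "g ` (X \<times> V) \<subseteq> L"
    using assms(1) by (auto simp: lepoll_def)
  obtain h where h: "bij_betw h M (Pow L)"
    using assms(2) by (auto simp: eqpoll_def)
  define ev where "ev t x = (THE v. v \<in> V \<and> g (x, v) \<in> h t)" for t x
  show ?thesis
  proof
    fix p assume p: "\<And>x. x \<in> X \<Longrightarrow> p x \<in> V"
    have "(\<lambda>x. g (x, p x)) ` X \<in> Pow L"
      using g p by auto
    then obtain t where t: "t \<in> M" "h t = (\<lambda>x. g (x, p x)) ` X"
      using h unfolding bij_betw_def by (metis imageE)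
    have "ev t x = p x" if "x \<in> X" for x
      unfolding ev_def
    proof (rule the_equality)
      show "p x \<in> V \<and> g (x, p x) \<in> h t"
        using p that t by auto
      fix v assume v: "v \<in> V \<and> g (x, v) \<in> h t"
      then obtain y where "y \<in> X" "g (x, v) = g (y, p y)"
        using t by auto
      then show "v = p x"
        using v p that inj_onD[OF g(1), of "(x, v)" "(y, p y)"] by auto
    qed
    then show "\<exists>t\<in>M. \<forall>x\<in>X. ev t x = p x"
      using t by blast
  qed
qed

section \<open>Linear families and uncolourability\<close>

text \<open>The intersection condition for \<open>\<mu> = 2\<close>, phrased through pairs of points
  so that no intersection has to be counted.\<close>

definition linear_family :: "'a set set \<Rightarrow> 'k set \<Rightarrow> bool" where
  "linear_family \<A> K \<longleftrightarrow> (\<forall>A\<in>\<A>. A \<approx> K) \<and>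
     (\<forall>A\<in>\<A>. \<forall>A'\<in>\<A>. \<forall>x\<in>A \<inter> A'. \<forall>y\<in>A \<inter> A'. x \<noteq> y \<longrightarrow> A = A')"

lemma linear_familyI:
  assumes "\<And>A. A \<in> \<A> \<Longrightarrow> A \<approx> K"
    and "\<And>A A' x y. \<lbrakk>A \<in> \<A>; A' \<in> \<A>; x \<in> A; x \<in> A'; y \<in> A; y \<in> A'; x \<noteq> y\<rbrakk> \<Longrightarrow> A = A'"
  shows "linear_family \<A> K"
  using assms unfolding linear_family_def by blast

lemma linear_familyD:
  "\<lbrakk>linear_family \<A> K; A \<in> \<A>; A' \<in> \<A>; x \<in> A; x \<in> A'; y \<in> A; y \<in> A'; x \<noteq> y\<rbrakk> \<Longrightarrow> A = A'"
  unfolding linear_family_def by blast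

lemma linear_family_eqpoll: "linear_family \<A> K \<Longrightarrow> A \<in> \<A> \<Longrightarrow> A \<approx> K"
  unfolding linear_family_def by blast

lemma is_system_iff_linear_family:
  "is_system \<A> L K {..<(2::nat)} \<longleftrightarrow> \<A> \<approx> L \<and> linear_family \<A> K"
proof -
  have "S \<prec> {..<(2::nat)} \<longleftrightarrow> (\<forall>x\<in>S. \<forall>y\<in>S. x = y)" for S :: "'a set"
  proof -
    have "S \<prec> {..<(2::nat)} \<longleftrightarrow> finite S \<and> card S \<le> 1"
      using lesspoll_iff_finite_card[of S 2] by auto
    also have "\<dots> \<longleftrightarrow> (\<forall>x\<in>S. \<forall>y\<in>S. x = y)"
    proof
      assume "finite S \<and> card S \<le> 1"
      then show "\<forall>x\<in>S. \<forall>y\<in>S. x = y"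
        using card_le_Suc0_iff_eq[of S] by auto
    next
      assume S: "\<forall>x\<in>S. \<forall>y\<in>S. x = y"
      then have "finite S"
        by (metis finite.emptyI finite_insert finite_subset insertI1 subsetI)
      with S show "finite S \<and> card S \<le> 1"
        using card_le_Suc0_iff_eq[of S] by auto
    qed
    finally show ?thesis .
  qed
  then show ?thesis
    unfolding is_system_def linear_family_def
    by (simp only:) (intro conj_cong ball_cong refl, blast)
qed

text \<open>In the following definition the colours \<open>\<ge> n\<close> play the role of "uncoloured".\<close>

definition uncolourable :: "nat \<Rightarrow> 'a set set \<Rightarrow> bool" where
  "uncolourable n \<A> \<longleftrightarrow> (\<forall>f :: 'a \<Rightarrow> nat. \<exists>A\<in>\<A>. \<forall>i<n. \<not> (\<exists>!x. x \<in> A \<and> f x = i))"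

lemma uncolourableD:
  assumes "uncolourable n \<A>"
  obtains A where "A \<in> \<A>" "\<And>i. i < n \<Longrightarrow> \<not> (\<exists>!x. x \<in> A \<and> f x = i)"
  using assms unfolding uncolourable_def by blast

lemma uncolourableI:
  fixes \<A> :: "'a set set"
  assumes "\<And>f :: 'a \<Rightarrow> nat. (\<And>A. A \<in> \<A> \<Longrightarrow> \<exists>i<n. \<exists>!x. x \<in> A \<and> f x = i) \<Longrightarrow> False"
  shows "uncolourable n \<A>"
proof -
  \<comment> \<open>The abstract \<open>U\<close> hides the unique existence from automation, so
    that only propositional reasoning is left.\<close>
  have gen: "\<forall>f. \<exists>A\<in>\<A>. \<forall>i<n. \<not> U f A i"
    if "\<And>f. (\<And>A. A \<in> \<A> \<Longrightarrow> \<exists>i<n. U f A i) \<Longrightarrow> False"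
    for U :: "('a \<Rightarrow> nat) \<Rightarrow> 'a set \<Rightarrow> nat \<Rightarrow> bool"
    using that by blast
  show ?thesis
    unfolding uncolourable_def by (rule gen) (rule assms)
qed

lemma uncolourable_mono: "uncolourable n \<A> \<Longrightarrow> \<A> \<subseteq> \<B> \<Longrightarrow> uncolourable n \<B>"
  unfolding uncolourable_def by (rule allI, drule spec, erule bexE, rule bexI, assumption, erule subsetD)

text \<open>A partial colouring becomes total by sending \<open>None\<close> to \<open>n\<close>.
  Since \<open>k \<le> n\<close>, every genuine colour is below \<open>n\<close>, so uniqueness of a
  genuine colour is unaffected.\<close>

lemma uncolourable_no_weak_cf_colouring:
  assumes "uncolourable n \<A>" "k \<le> n"
  shows "\<not> weak_cf_colouring \<A> {..<k} f"
proof
  assume f: "weak_cf_colouring \<A> {..<k} f"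
  obtain A where A: "A \<in> \<A>"
      "\<And>i. i < n \<Longrightarrow> \<not> (\<exists>!x. x \<in> A \<and> (case f x of None \<Rightarrow> n | Some z \<Rightarrow> z) = i)"
    using uncolourableD[OF assms(1), of "\<lambda>x. case f x of None \<Rightarrow> n | Some z \<Rightarrow> z"] by blast
  obtain z where "card {x\<in>A. f x = Some z} = 1"
    using f A(1) unfolding weak_cf_colouring_def by blast
  then obtain x where x: "{x\<in>A. f x = Some z} = {x}"
    by (auto simp: card_1_singleton_iff)
  then have fx: "x \<in> A" "f x = Some z"
    by auto
  then have "z < n"
    using f assms(2) unfolding weak_cf_colouring_def ran_def by fastforce
  moreover from this have "(case f y of None \<Rightarrow> n | Some z \<Rightarrow> z) = z \<longleftrightarrow> f y = Some z" for y
    by (auto split: option.split)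
  ultimately show False
    using A(2)[of z] x fx by (metis (mono_tags, lifting) mem_Collect_eq singletonD)
qed

lemma linear_family_image:
  assumes "linear_family \<A> K" "inj_on g (\<Union>\<A>)"
  shows "linear_family ((`) g ` \<A>) K"
proof (rule linear_familyI)
  fix A assume "A \<in> (`) g ` \<A>"
  then obtain A0 where A0: "A0 \<in> \<A>" "A = g ` A0"
    by blast
  then have "inj_on g A0"
    using assms(2) by (meson Union_upper inj_on_subset)
  then show "A \<approx> K"
    using A0 linear_family_eqpoll[OF assms(1)] by simp
next
  fix A A' x y
  assume *: "A \<in> (`) g ` \<A>" "A' \<in> (`) g ` \<A>" "x \<in> A" "x \<in> A'" "y \<in> A" "y \<in> A'" "x \<noteq> y"
  then obtain A0 A1 where A: "A0 \<in> \<A>" "A = g ` A0" "A1 \<in> \<A>" "A' = g ` A1"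
    by blast
  with * obtain a b c d where ab: "a \<in> A0" "x = g a" "b \<in> A0" "y = g b"
      "c \<in> A1" "x = g c" "d \<in> A1" "y = g d"
    by blast
  then have "a = c" "b = d"
    using A inj_onD[OF assms(2)] by (metis UnionI)+
  then show "A = A'"
    using linear_familyD[OF assms(1), of A0 A1 a b] A ab * by auto
qed

lemma uncolourable_image:
  assumes "uncolourable n \<A>" "inj_on g (\<Union>\<A>)"
  shows "uncolourable n ((`) g ` \<A>)"
  unfolding uncolourable_def
proof
  fix f :: "'b \<Rightarrow> nat"
  obtain A where A: "A \<in> \<A>" "\<And>i. i < n \<Longrightarrow> \<not> (\<exists>!x. x \<in> A \<and> f (g x) = i)"
    using uncolourableD[OF assms(1), of "f \<circ> g"] by auto
  have "inj_on g A"
    using A assms(2) by (meson Union_upper inj_on_subset)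
  then have "\<not> (\<exists>!x. x \<in> g ` A \<and> f x = i)" if "i < n" for i
    using A(2)[OF that] by (smt (verit, best) image_iff inj_on_def)
  then show "\<exists>A\<in>(`) g ` \<A>. \<forall>i<n. \<not> (\<exists>!x. x \<in> A \<and> f x = i)"
    using A(1) by blast
qed

text \<open>The member of \<open>\<A>\<close> itself is returned rather than its image, because it
  later indexes the extended set in the copy.\<close>

lemma uncolourable_imageD:
  assumes "uncolourable n \<A>" "inj_on g (\<Union>\<A>)"
  obtains A where "A \<in> \<A>" "\<And>i. i < n \<Longrightarrow> \<not> (\<exists>!x. x \<in> g ` A \<and> f x = i)"
proof -
  obtain B where B: "B \<in> (`) g ` \<A>" "\<And>i. i < n \<Longrightarrow> \<not> (\<exists>!x. x \<in> B \<and> f x = i)"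
    by (rule uncolourableD[OF uncolourable_image[OF assms], where f = f]) (rule that)
  from B(1) obtain A where "A \<in> \<A>" "B = g ` A"
    by (rule imageE)
  with B(2) show ?thesis
    using that by simp
qed

text \<open>Pairwise disjoint sets are added to reach the size of \<open>L\<close> exactly.\<close>

lemma pad_and_transfer:
  fixes \<A> :: "'a set set" and L :: "'b set" and K :: "'k set"
  assumes inf: "infinite K" "infinite L" and le: "K \<lesssim> L" "\<A> \<lesssim> L"
    and lin: "linear_family \<A> K" and unc: "uncolourable n \<A>"
  shows "\<exists>\<B> :: 'b set set. \<B> \<approx> L \<and> linear_family \<B> K \<and> uncolourable n \<B>"
proof -
  \<comment> \<open>The sum type supplies fresh points: the sets \<open>D l\<close> avoid the copy
    of \<open>\<A>\<close> under \<open>Inl\<close> and each other.\<close>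
  define D :: "'b \<Rightarrow> ('a + 'b \<times> 'k) set" where "D l = Inr ` ({l} \<times> K)" for l
  define \<C> where "\<C> = (`) Inl ` \<A> \<union> D ` L"
  have "K \<noteq> {}"
    using inf by auto
  then have "inj_on D L"
    by (auto simp: D_def inj_on_def image_iff)
  then have DL: "D ` L \<approx> L"
    by simp
  have "(`) Inl ` \<A> \<lesssim> L"
    by (rule lepoll_trans[OF image_lepoll le(2)])
  then have "\<C> \<lesssim> L"
    unfolding \<C>_def using DL inf(2) by (intro lepoll_Un_infinite) (auto intro: eqpoll_imp_lepoll)
  moreover have "L \<lesssim> \<C>"
    using DL by (metis \<C>_def Un_upper2 eqpoll_sym lepoll_trans1 subset_imp_lepoll)
  ultimately have C: "\<C> \<approx> L"
    by (rule lepoll_antisym)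
  have linC: "linear_family \<C> K"
  proof (rule linear_familyI)
    fix A assume "A \<in> \<C>"
    then show "A \<approx> K"
      using linear_family_eqpoll[OF lin] times_singleton_eqpoll
      by (auto simp: \<C>_def D_def)
  next
    fix A A' x y
    assume "A \<in> \<C>" "A' \<in> \<C>" "x \<in> A" "x \<in> A'" "y \<in> A" "y \<in> A'" "x \<noteq> y"
    then show "A = A'"
      unfolding \<C>_def D_def by (auto dest: linear_familyD[OF lin])
  qed
  have uncC: "uncolourable n \<C>"
    unfolding \<C>_def
    by (rule uncolourable_mono[OF uncolourable_image[OF unc, of Inl]]) auto
  \<comment> \<open>Members of size at most \<open>L\<close> keep the whole union within
    \<open>L\<close>, so the family embeds into the type \<open>'b\<close>. This brings each
    construction back to a fixed ground type.\<close>
  have "A \<lesssim> L" if "A \<in> \<C>" for A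
    using linear_family_eqpoll[OF linC that] le(1) by (rule lepoll_trans1)
  then have "\<Union>\<C> \<lesssim> L"
    by (rule lepoll_Union_infinite[OF inf(2) eqpoll_imp_lepoll[OF C]])
  then obtain g :: "_ \<Rightarrow> 'b" where g: "inj_on g (\<Union>\<C>)"
    by (auto simp: lepoll_def)
  have "inj_on ((`) g) \<C>"
    using g by (meson PowI Union_upper inj_on_image_Pow inj_on_subset subsetI)
  then have "(`) g ` \<C> \<approx> L"
    using C by simp
  then show ?thesis
    using linear_family_image[OF linC g] uncolourable_image[OF uncC g] by blast
qed

section \<open>One colour\<close>

text \<open>Both \<open>P\<close> K\<open>and\<close>Q \<open>K\<close> would need a point of colour
  0, say \<open>P x\<close> and \<open>Q y\<close>; then \<open>T (x, y)\<close> contains two such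
  points. The points \<open>R x y z\<close> are private to \<open>T (x, y)\<close> and only bring it
  to the size of \<open>K\<close>.\<close>

lemma uncolourable_one_colour:
  fixes K :: "'k set"
  assumes "infinite K"
  shows "\<exists>\<A> :: ('k + 'k + 'k \<times> 'k \<times> 'k) set set.
    \<A> \<lesssim> K \<and> linear_family \<A> K \<and> uncolourable 1 \<A>"
proof -
  define P :: "'k \<Rightarrow> 'k + 'k + 'k \<times> 'k \<times> 'k" where "P x = Inl x" for x
  define Q :: "'k \<Rightarrow> 'k + 'k + 'k \<times> 'k \<times> 'k" where "Q x = Inr (Inl x)" for x
  define R :: "'k \<Rightarrow> 'k \<Rightarrow> 'k \<Rightarrow> 'k + 'k + 'k \<times> 'k \<times> 'k" where "R x y z = Inr (Inr (x, y, z))" for x y z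
  note defs = P_def Q_def R_def
  define T where "T = (\<lambda>(x, y). insert (P x) (insert (Q y) (R x y ` K)))"
  define \<A> where "\<A> = {P ` K, Q ` K} \<union> T ` (K \<times> K)"
  have "T ` (K \<times> K) \<lesssim> K"
    by (intro lepoll_trans[OF image_lepoll] lepoll_Times_infinite assms lepoll_refl)
  then have "\<A> \<lesssim> K"
    unfolding \<A>_def using assms by (intro lepoll_Un_infinite) (auto intro: finite_lepoll_infinite)
  moreover have "linear_family \<A> K"
  proof (rule linear_familyI)
    have inj: "inj_on P K" "inj_on Q K" "\<And>x y. inj_on (R x y) K"
      by (auto simp: inj_on_def defs)
    have "T (x, y) \<approx> K" for x y
    proof -
      have "R x y ` K \<approx> K" and "infinite (R x y ` K)"
        using inj assms by (auto simp: finite_image_iff)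
      then show ?thesis
        unfolding T_def prod.case
        by (meson eqpoll_trans infinite_insert_eqpoll finite_insert)
    qed
    then show "A \<approx> K" if "A \<in> \<A>" for A
      using that inj unfolding \<A>_def by auto
  next
    fix A A' x y
    assume "A \<in> \<A>" "A' \<in> \<A>" "x \<in> A" "x \<in> A'" "y \<in> A" "y \<in> A'" "x \<noteq> y"
    then show "A = A'"
      unfolding \<A>_def T_def by (auto simp: defs)
  qed
  moreover have "uncolourable 1 \<A>"
  proof (rule uncolourableI)
    fix f :: "'k + 'k + 'k \<times> 'k \<times> 'k \<Rightarrow> nat"
    assume "\<And>A. A \<in> \<A> \<Longrightarrow> \<exists>i<1. \<exists>!x. x \<in> A \<and> f x = i"
    then have *: "\<exists>!x. x \<in> A \<and> f x = 0" if "A \<in> \<A>" for A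
      using that by auto
    have "P ` K \<in> \<A>" "Q ` K \<in> \<A>"
      by (auto simp: \<A>_def)
    then obtain x y where xy: "x \<in> K" "f (P x) = 0" "y \<in> K" "f (Q y) = 0"
      using ex1_implies_ex[OF *[of "P ` K"]] ex1_implies_ex[OF *[of "Q ` K"]] by blast
    then have "T (x, y) \<in> \<A>"
      by (auto simp: \<A>_def)
    then have "P x = Q y"
      using *[of "T (x, y)"] xy by (auto simp: T_def)
    then show False
      by (simp add: defs)
  qed
  ultimately show ?thesis
    by blast
qed

section \<open>One more colour\<close>

lemma uncolourable_Suc:
  fixes \<A> :: "'a set set" and K :: "'k set" and L :: "'l set" and M :: "'m set" and N :: "'n set"
  assumes inf: "infinite K" and le: "K \<lesssim> L" "\<A> \<lesssim> L"
    and M: "M \<approx> Pow L" and N: "N \<approx> Pow M"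
    and lin: "linear_family \<A> K" and unc: "uncolourable n \<A>"
  shows "\<exists>\<B> :: ('a \<times> 'm \<times> 'n + 'a \<times> 'a set \<times> 'n + 'a \<times> 'a set \<times> 'm) set set.
    \<B> \<lesssim> N \<and> linear_family \<B> K \<and> uncolourable (Suc n) \<B>"
proof -
  have L: "infinite L"
    by (rule lepoll_infinite[OF le(1) inf])
  have LM: "L \<lesssim> M"
    using M lepoll_Pow_self by (meson eqpoll_sym lepoll_trans2)
  have MN: "M \<lesssim> N"
    using N lepoll_Pow_self by (meson eqpoll_sym lepoll_trans2)
  have iM: "infinite M"
    by (rule lepoll_infinite[OF LM L])
  have iN: "infinite N"
    by (rule lepoll_infinite[OF MN iM])
  have "A \<lesssim> L" if "A \<in> \<A>" for A
    using linear_family_eqpoll[OF lin that] le(1) by (rule lepoll_trans1)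
  then have V: "\<Union>\<A> \<lesssim> L"
    using L le(2) by (intro lepoll_Union_infinite)
  obtain ev :: "'m \<Rightarrow> 'a set \<Rightarrow> 'a" where ev:
    "\<And>p. (\<And>A. A \<in> \<A> \<Longrightarrow> p A \<in> \<Union>\<A>) \<Longrightarrow> \<exists>t\<in>M. \<forall>A\<in>\<A>. ev t A = p A"
    using power_set_codes_functions[OF lepoll_Times_infinite[OF L le(2) V] M] by blast
  \<comment> \<open>The second code takes all \<open>t\<close> in \<open>M\<close> as arguments,
    which is why it needs another power set, that of \<open>M\<close>.\<close>
  have "(\<A> \<times> M) \<times> \<Union>\<A> \<lesssim> M"
    using le(2) V LM by (intro lepoll_Times_infinite iM) (auto intro: lepoll_trans)
  then obtain ev' :: "'n \<Rightarrow> 'a set \<times> 'm \<Rightarrow> 'a" where ev':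
    "\<And>p. (\<And>z. z \<in> \<A> \<times> M \<Longrightarrow> p z \<in> \<Union>\<A>) \<Longrightarrow> \<exists>u\<in>N. \<forall>z\<in>\<A> \<times> M. ev' u z = p z"
    using power_set_codes_functions[OF _ N] by blast
  \<comment> \<open>\<open>P t u\<close> embeds the main copy, \<open>Q A u\<close> and
    \<open>R A t\<close> the auxiliary ones. Each point carries the index of its copy.\<close>
  define P :: "'m \<Rightarrow> 'n \<Rightarrow> 'a \<Rightarrow> 'a \<times> 'm \<times> 'n + 'a \<times> 'a set \<times> 'n + 'a \<times> 'a set \<times> 'm"
    where "P t u x = Inl (x, t, u)" for t u x
  define Q :: "'a set \<Rightarrow> 'n \<Rightarrow> 'a \<Rightarrow> 'a \<times> 'm \<times> 'n + 'a \<times> 'a set \<times> 'n + 'a \<times> 'a set \<times> 'm"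
    where "Q A u x = Inr (Inl (x, A, u))" for A u x
  define R :: "'a set \<Rightarrow> 'm \<Rightarrow> 'a \<Rightarrow> 'a \<times> 'm \<times> 'n + 'a \<times> 'a set \<times> 'n + 'a \<times> 'a set \<times> 'm"
    where "R A t x = Inr (Inr (x, A, t))" for A t x
  note defs = P_def Q_def R_def
  define E where "E = (\<lambda>(A, t, u). insert (Q A u (ev t A)) (insert (R A t (ev' u (A, t))) (P t u ` A)))"
  define \<B>\<^sub>1 where "\<B>\<^sub>1 = E ` (\<A> \<times> M \<times> N)"
  define \<B>\<^sub>2 where "\<B>\<^sub>2 = (\<lambda>(A, A', u). Q A' u ` A) ` (\<A> \<times> \<A> \<times> N)"
  define \<B>\<^sub>3 where "\<B>\<^sub>3 = (\<lambda>(A, A', t). R A' t ` A) ` (\<A> \<times> \<A> \<times> M)"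
  define \<B> where "\<B> = \<B>\<^sub>1 \<union> \<B>\<^sub>2 \<union> \<B>\<^sub>3"
  have AN: "\<A> \<lesssim> N"
    by (rule lepoll_trans[OF lepoll_trans[OF le(2) LM] MN])
  have "\<A> \<times> M \<times> N \<lesssim> N" "\<A> \<times> \<A> \<times> N \<lesssim> N" "\<A> \<times> \<A> \<times> M \<lesssim> N"
    by (rule lepoll_Times_infinite[OF iN] AN MN lepoll_refl)+
  then have "\<B>\<^sub>1 \<lesssim> N" "\<B>\<^sub>2 \<lesssim> N" "\<B>\<^sub>3 \<lesssim> N"
    unfolding \<B>\<^sub>1_def \<B>\<^sub>2_def \<B>\<^sub>3_def by (auto intro: lepoll_trans[OF image_lepoll])
  then have "\<B> \<lesssim> N"
    unfolding \<B>_def by (intro lepoll_Un_infinite iN)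
  moreover have "linear_family \<B> K"
  proof (rule linear_familyI)
    have inj: "inj_on (P t u) S" "inj_on (Q A u) S" "inj_on (R A t) S" for t u A S
      by (auto simp: inj_on_def defs)
    have "E (A, t, u) \<approx> K" if "A \<in> \<A>" for A t u
    proof -
      have "P t u ` A \<approx> K"
        using inj linear_family_eqpoll[OF lin that] by auto
      moreover from this have "infinite (P t u ` A)"
        using inf eqpoll_finite_iff by blast
      ultimately show ?thesis
        unfolding E_def prod.case
        by (meson eqpoll_trans infinite_insert_eqpoll finite_insert)
    qed
    then show "A \<approx> K" if "A \<in> \<B>" for A
      using that inj linear_family_eqpoll[OF lin] unfolding \<B>_def \<B>\<^sub>1_def \<B>\<^sub>2_def \<B>\<^sub>3_def by auto
  next
    fix A A' x y
    assume *: "A \<in> \<B>" "A' \<in> \<B>" "x \<in> A" "x \<in> A'" "y \<in> A" "y \<in> A'" "x \<noteq> y"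
    from *(1,2) show "A = A'"
      unfolding \<B>_def
    proof (elim UnE)
      assume "A \<in> \<B>\<^sub>1" "A' \<in> \<B>\<^sub>1"
      then obtain S t u S' t' u' where S: "S \<in> \<A>" "A = E (S, t, u)" "S' \<in> \<A>" "A' = E (S', t', u')"
        unfolding \<B>\<^sub>1_def by blast
      \<comment> \<open>A shared extra point reveals \<open>S\<close>, and together with any other
        shared point also \<open>t\<close> and \<open>u\<close>. Otherwise both shared points lie in
        the main copy, where linearity of \<open>\<A>\<close> applies.\<close>
      then have "t = t' \<and> u = u' \<and> (S = S' \<or> (\<exists>a b. {a, b} \<subseteq> S \<and> {a, b} \<subseteq> S' \<and> a \<noteq> b))"
        using *(3-) by (auto simp: E_def defs)
      then show ?thesis
        using S linear_familyD[OF lin S(1,3)] by (metis insert_subset)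
    next
      assume "A \<in> \<B>\<^sub>2" "A' \<in> \<B>\<^sub>2"
      then obtain S T u S' T' u' where S: "S \<in> \<A>" "A = Q T u ` S" "S' \<in> \<A>" "A' = Q T' u' ` S'"
        unfolding \<B>\<^sub>2_def by auto
      then have "T = T' \<and> u = u' \<and> (\<exists>a b. {a, b} \<subseteq> S \<and> {a, b} \<subseteq> S' \<and> a \<noteq> b)"
        using *(3-) by (auto simp: defs)
      then show ?thesis
        using S linear_familyD[OF lin S(1,3)] by (metis insert_subset)
    next
      assume "A \<in> \<B>\<^sub>3" "A' \<in> \<B>\<^sub>3"
      then obtain S T t S' T' t' where S: "S \<in> \<A>" "A = R T t ` S" "S' \<in> \<A>" "A' = R T' t' ` S'"
        unfolding \<B>\<^sub>3_def by auto
      then have "T = T' \<and> t = t' \<and> (\<exists>a b. {a, b} \<subseteq> S \<and> {a, b} \<subseteq> S' \<and> a \<noteq> b)"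
        using *(3-) by (auto simp: defs)
      then show ?thesis
        using S linear_familyD[OF lin S(1,3)] by (metis insert_subset)
    \<comment> \<open>In the mixed cases two distinct common points are impossible: an extended set
      has only one point in each of the \<open>Q\<close> and \<open>R\<close> parts, and these parts
      are disjoint.\<close>
    qed (use *(3-) in \<open>auto simp: \<B>\<^sub>1_def \<B>\<^sub>2_def \<B>\<^sub>3_def E_def defs\<close>)
  qed
  moreover have "uncolourable (Suc n) \<B>"
  proof (rule uncolourableI)
    fix f :: "'a \<times> 'm \<times> 'n + 'a \<times> 'a set \<times> 'n + 'a \<times> 'a set \<times> 'm \<Rightarrow> nat"
    assume cf: "\<exists>i<Suc n. \<exists>!x. x \<in> A \<and> f x = i" if "A \<in> \<B>" for A
    have last_colour: "\<exists>x\<in>\<Union>\<A>. f (e x) = n" if "inj e" "\<And>A. A \<in> \<A> \<Longrightarrow> e ` A \<in> \<B>" for e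
    proof (rule ccontr)
      assume none: "\<not> (\<exists>x\<in>\<Union>\<A>. f (e x) = n)"
      have "inj_on e (\<Union>\<A>)"
        using that(1) by (meson inj_on_subset subset_UNIV)
      then obtain A where A: "A \<in> \<A>" "\<And>i. i < n \<Longrightarrow> \<not> (\<exists>!x. x \<in> e ` A \<and> f x = i)"
        by (rule uncolourable_imageD[OF unc, where f = f]) (rule that)
      from cf[OF that(2)[OF A(1)]]
      obtain i where i: "i < Suc n" "\<exists>!x. x \<in> e ` A \<and> f x = i"
        by (elim exE conjE) (rule that)
      then have "i = n"
        using A(2) less_antisym by blast
      then show False
        using ex1_implies_ex[OF i(2)] A(1) none by blast
    qed
    have "\<exists>x\<in>\<Union>\<A>. f (Q A u x) = n" if "A \<in> \<A>" "u \<in> N" for A u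
      using that by (intro last_colour) (force simp: inj_def defs \<B>_def \<B>\<^sub>2_def)+
    then obtain q where q: "\<And>A u. A \<in> \<A> \<Longrightarrow> u \<in> N \<Longrightarrow> q A u \<in> \<Union>\<A> \<and> f (Q A u (q A u)) = n"
      by metis
    have "\<exists>x\<in>\<Union>\<A>. f (R A t x) = n" if "A \<in> \<A>" "t \<in> M" for A t
      using that by (intro last_colour) (force simp: inj_def defs \<B>_def \<B>\<^sub>3_def)+
    then obtain r where r: "\<And>A t. A \<in> \<A> \<Longrightarrow> t \<in> M \<Longrightarrow> r A t \<in> \<Union>\<A> \<and> f (R A t (r A t)) = n"
      by metis
    \<comment> \<open>The order matters: \<open>r\<close> does not involve \<open>u\<close>, so
      \<open>u\<close> can be fixed for all \<open>t\<close> at once. Only then is \<open>t\<close>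
      chosen to follow \<open>q\<close> at this \<open>u\<close>.\<close>
    obtain u where u: "u \<in> N" "\<And>A t. A \<in> \<A> \<Longrightarrow> t \<in> M \<Longrightarrow> ev' u (A, t) = r A t"
      using ev'[of "\<lambda>(A, t). r A t"] r by fastforce
    obtain t where t: "t \<in> M" "\<And>A. A \<in> \<A> \<Longrightarrow> ev t A = q A u"
      using ev[of "\<lambda>A. q A u"] q u(1) by blast
    have "inj_on (P t u) (\<Union>\<A>)"
      by (auto simp: inj_on_def defs)
    then obtain A where A: "A \<in> \<A>" "\<And>i. i < n \<Longrightarrow> \<not> (\<exists>!x. x \<in> P t u ` A \<and> f x = i)"
      by (rule uncolourable_imageD[OF unc, where f = f]) (rule that)
    define a where "a = Q A u (ev t A)"
    define b where "b = R A t (ev' u (A, t))"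
    have ab: "f a = n" "f b = n" "a \<noteq> b"
      using q r u t A(1) by (auto simp: a_def b_def) (auto simp: defs)
    have EA: "E (A, t, u) = insert a (insert b (P t u ` A))"
      by (simp add: E_def a_def b_def)
    have "E (A, t, u) \<in> \<B>"
      using A(1) t(1) u(1) by (auto simp: \<B>_def \<B>\<^sub>1_def)
    from cf[OF this] obtain i where i: "i < Suc n" "\<exists>!x. x \<in> E (A, t, u) \<and> f x = i"
      by (elim exE conjE) (rule that)
    show False
    \<comment> \<open>Colour \<open>n\<close> occurs at both \<open>a\<close> and \<open>b\<close>,
      so it is not unique; for a smaller colour these two points do not count, and \<open>A\<close>
      is bad already.\<close>
    proof (cases "i = n")
      case True
      then show False
        using i(2) ab unfolding EA by (metis insertCI)
    next
      case False
      then have "x \<in> E (A, t, u) \<and> f x = i \<longleftrightarrow> x \<in> P t u ` A \<and> f x = i" for x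
        using ab unfolding EA by auto
      then show False
        using i A(2)[of i] False by (simp add: less_Suc_eq)
    qed
  qed
  ultimately show ?thesis
    by blast
qed

section \<open>Iteration along the beth chain\<close>

lemma beth_chain_lepoll:
  assumes "beth_chain m B" "i \<le> j" "j \<le> m"
  shows "B i \<lesssim> B j"
  using assms(2,3)
proof (induction rule: dec_induct)
  case (step k)
  then have "B (Suc k) \<approx> Pow (B k)"
    using assms(1) by (simp add: beth_chain_def)
  then have "B k \<lesssim> B (Suc k)"
    by (meson eqpoll_sym lepoll_Pow_self lepoll_trans2)
  with step show ?case
    by (meson Suc_leD lepoll_trans)
qed simp

text \<open>Each induction step climbs two levels of the chain, with \<open>B (Suc (2 * j))\<close>
  as \<open>M\<close> and \<open>B (2 * Suc j)\<close> as \<open>N\<close>. Padding then restores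
  the type \<open>'b\<close> and the exact size.\<close>

lemma beth_chain_uncolourable:
  fixes B :: "nat \<Rightarrow> 'b set"
  assumes inf: "infinite (B 0)" and beth: "beth_chain m B" and "2 * j \<le> m"
  shows "\<exists>\<A> :: 'b set set. \<A> \<approx> B (2 * j) \<and> linear_family \<A> (B 0) \<and> uncolourable (Suc j) \<A>"
  using assms(3)
proof (induction j)
  case 0
  show ?case
    using uncolourable_one_colour[OF inf] pad_and_transfer[OF inf inf lepoll_refl] by auto
next
  case (Suc j)
  then obtain \<A> :: "'b set set" where
    A: "\<A> \<approx> B (2 * j)" "linear_family \<A> (B 0)" "uncolourable (Suc j) \<A>"
    by auto
  have le: "B 0 \<lesssim> B i" if "i \<le> m" for i
    using beth_chain_lepoll[OF beth _ that] by simp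
  have "B (Suc (2 * j)) \<approx> Pow (B (2 * j))" "B (2 * Suc j) \<approx> Pow (B (Suc (2 * j)))"
    using beth Suc.prems by (auto simp: beth_chain_def)
  from uncolourable_Suc[OF inf le eqpoll_imp_lepoll[OF A(1)] this A(2,3)]
  obtain \<B> :: "('b \<times> 'b \<times> 'b + 'b \<times> 'b set \<times> 'b + 'b \<times> 'b set \<times> 'b) set set"
    where "\<B> \<lesssim> B (2 * Suc j)" "linear_family \<B> (B 0)" "uncolourable (Suc (Suc j)) \<B>"
    using Suc.prems by auto
  moreover have "infinite (B (2 * Suc j))"
    by (rule lepoll_infinite[OF le[OF Suc.prems] inf])
  ultimately show ?case
    using pad_and_transfer[OF inf _ le[OF Suc.prems]] by blast
qed

theorem theorem6p8:
  fixes B :: "nat \<Rightarrow> 'b set" and m :: nat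
  assumes "infinite (B 0)"
    and "beth_chain m B"
  shows "\<exists>\<A>::'b set set. is_system \<A> (B m) (B 0) {..<(2::nat)} \<and>
           (\<forall>k::nat. k < m div 2 + 2 \<longrightarrow> \<not> (\<exists>f::'b \<Rightarrow> nat option. weak_cf_colouring \<A> {..<k} f))"
proof -
  have le: "B i \<lesssim> B m" if "i \<le> m" for i
    using beth_chain_lepoll[OF assms(2) that] by simp
  \<comment> \<open>The even level \<open>2 * (m div 2)\<close> is \<open>m\<close> or
    \<open>m - 1\<close>; for odd \<open>m\<close>, padding bridges the last level without gaining a
    colour.\<close>
  obtain \<A> :: "'b set set" where A: "\<A> \<approx> B (2 * (m div 2))"
      "linear_family \<A> (B 0)" "uncolourable (Suc (m div 2)) \<A>"
    using beth_chain_uncolourable[OF assms, of "m div 2"] by auto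
  have "infinite (B m)"
    by (rule lepoll_infinite[OF le[of 0] assms(1)]) simp
  moreover have "\<A> \<lesssim> B m"
    using A(1) le[of "2 * (m div 2)"] by (simp add: lepoll_trans1)
  ultimately obtain \<B> :: "'b set set" where
    B: "\<B> \<approx> B m" "linear_family \<B> (B 0)" "uncolourable (Suc (m div 2)) \<B>"
    using pad_and_transfer[OF assms(1) _ le[of 0] _ A(2,3)] by blast
  \<comment> \<open>The bound on \<open>k\<close> amounts to
    \<open>k \<le> Suc (m div 2)\<close>.\<close>
  then have "\<not> weak_cf_colouring \<B> {..<k} f" if "k < m div 2 + 2" for k f
    using that by (intro uncolourable_no_weak_cf_colouring) auto
  with B show ?thesis
    unfolding is_system_iff_linear_family by blast
qed

end
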